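(* Let $A\subseteq\mathbb{R}\setminus\{0\}$ be finite. Then there are sets $X,Y\subseteq A$ with $X\cup Y=A$ and $|X|,|Y|\ge |A|/2$ such that \[ E_3^+(X)^4\,E^\times(Y)^3\lesssim |A|^{22}. \]
   Context: $E_3^+(X)=\sum_x r_{X-X}(x)^3$ where $r_{X-X}(x)=\#\{(a,b)\in X^2:a-b=x\}$; $E^\times(Y)=\#\{(y_1,y_2,y_3,y_4)\in Y^4: y_1y_2=y_3y_4\}$. Notation: $P\lesssim Q$ means $P\le C\,Q(\log(2+|A|))^{c}$ for absolute constants $C,c>0$. *)

theory Defs
  imports Complex_Main
begin

definition rdiff :: "real set \<Rightarrow> real \<Rightarrow> nat" where
  "rdiff X x = card {(a, b). a \<in> X \<and> b \<in> X \<and> a - b = x}"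

definition E3plus :: "real set \<Rightarrow> nat" where
  "E3plus X = (\<Sum>x \<in> {a - b | a b. a \<in> X \<and> b \<in> X}. rdiff X x ^ 3)"

definition Emult :: "real set \<Rightarrow> nat" where
  "Emult Y = card {(y1, y2, y3, y4). y1 \<in> Y \<and> y2 \<in> Y \<and> y3 \<in> Y \<and> y4 \<in> Y \<and> y1 * y2 = y3 * y4}"

end

(* Let X minimise the third energy E3 among the subsets of A with half of its elements.
   Exchanging an element of X for one outside X cannot lower E3, so every y outside X, and
   also one suitable x in X, has large weight f(y) = sum over a in A of (r_{X-X}(a - y) + 2)^2,
   namely f(y) >> E3(X) / |A|.  Y consists of these elements.

   The multiplicative energy of the weight f is bounded by an energy version of Solymosi's
   14/11 argument.  For y, l*y in Y and a, b in A the points (a, b) and (a - y, b - l*y) lie on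
   a common line of slope l.  Hence the popular slopes give many lines that meet both A x A and
   the difference grid, and Szemeredi-Trotter limits their number.  As all point sets are
   Cartesian products, Szemeredi-Trotter has an elementary proof: cut the grid into blocks; a
   line is monotone, so it meets few blocks, and inside the blocks two points determine a line. *)
theory Submission
  imports Defs
begin

section \<open>Incidences of lines with grids\<close>

text \<open>A pair \<open>e\<close> stands for the line with slope \<open>fst e\<close> and
  intercept \<open>snd e\<close>. A point of the grid P x Q on it is identified by its abscissa, so
  vertical lines never arise.\<close>

definition line_inc :: "real set \<Rightarrow> real set \<Rightarrow> real \<times> real \<Rightarrow> nat" where
  "line_inc P Q e = card {p \<in> P. fst e * p + snd e \<in> Q}"

text \<open>Choose one representative in each fibre of \<open>h\<close>; every other element of
  \<open>S\<close> collides with the representative of its own fibre. With \<open>h\<close> sending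
  a point to its cell, this splits the incidences of a line into cells met and pairs sharing a
  cell.\<close>

lemma card_le_image_plus_collisions:
  assumes "finite S"
  shows "card S \<le> card (h ` S) + card {(p, p'). p \<in> S \<and> p' \<in> S \<and> p \<noteq> p' \<and> h p = h p'}"
proof -
  let ?R = "inv_into S h ` h ` S" and ?C = "{(p, p'). p \<in> S \<and> p' \<in> S \<and> p \<noteq> p' \<and> h p = h p'}"
  have RS: "?R \<subseteq> S" by (auto intro: inv_into_into)
  have fC: "finite ?C" by (rule finite_subset[of _ "S \<times> S"]) (use assms in auto)
  have "card (S - ?R) \<le> card ?C"
  proof (rule card_inj_on_le[where f = "\<lambda>p. (inv_into S h (h p), p)"])
    show "inj_on (\<lambda>p. (inv_into S h (h p), p)) (S - ?R)" by (auto simp: inj_on_def)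
    show "(\<lambda>p. (inv_into S h (h p), p)) ` (S - ?R) \<subseteq> ?C"
      by (auto intro: inv_into_into simp: f_inv_into_f) (metis imageI)
  qed (rule fC)
  moreover have "card S = card ?R + card (S - ?R)"
    using assms RS by (metis card_Diff_subset card_mono finite_subset le_add_diff_inverse)
  moreover have "card ?R \<le> card (h ` S)" using assms by (intro card_image_le) auto
  ultimately show ?thesis by linarith
qed

text \<open>The index of \<open>p\<close> when \<open>P\<close> is cut into runs of \<open>s\<close>
  consecutive elements. Going through the rank makes the index defined and monotone on all reals,
  with values from 0 to \<open>card P div s\<close>.\<close>

definition block :: "real set \<Rightarrow> nat \<Rightarrow> real \<Rightarrow> nat" where
  "block P s p = card {x \<in> P. x < p} div s"

lemma block_mono: "finite P \<Longrightarrow> p \<le> p' \<Longrightarrow> block P s p \<le> block P s p'"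
  unfolding block_def by (intro div_le_mono card_mono) auto

lemma block_le: "finite P \<Longrightarrow> block P s p \<le> card P div s"
  unfolding block_def by (intro div_le_mono card_mono) auto

lemma card_block_le:
  assumes "finite P" "s > 0"
  shows "card {p \<in> P. block P s p = v} \<le> s"
proof -
  let ?rank = "\<lambda>p. card {x \<in> P. x < p}"
  have less: "?rank p < ?rank p'" if "p \<in> P" "p < p'" for p p'
    using assms that by (intro psubset_card_mono) auto
  have "inj_on ?rank P"
    by (intro linorder_inj_onI') (use less in fastforce)
  then have "inj_on ?rank {p \<in> P. block P s p = v}" by (rule inj_on_subset) auto
  moreover have "?rank p \<in> {v * s..<v * s + s}" if "block P s p = v" for p
    using that div_mult_mod_eq[of "?rank p" s] mod_less_divisor[OF assms(2), of "?rank p"]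
    unfolding block_def by (simp only: atLeastLessThan_iff) linarith
  then have "?rank ` {p \<in> P. block P s p = v} \<subseteq> {v * s..<v * s + s}" by blast
  ultimately have "card {p \<in> P. block P s p = v} \<le> card {v * s..<v * s + s}"
    by (rule card_inj_on_le) simp
  then show ?thesis by simp
qed

text \<open>A line of nonzero slope is monotone, so along it both block indices move monotonically
  and the cells form a staircase. On a staircase the cells are told apart by a single
  integer.\<close>

lemma card_cells_on_line:
  assumes fin: "finite P" "finite Q" and "l \<noteq> 0" and S: "S \<subseteq> P"
  shows "card ((\<lambda>p. (block P s p, block Q s' (l * p + c))) ` S) \<le> card P div s + card Q div s' + 1"
    (is "card (?h ` S) \<le> ?m")
proof -
  \<comment> \<open>The position along the staircase: the sum of the two indices, with the second
    one reversed when the line descends. It takes at most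
    \<open>card P div s + card Q div s' + 1\<close> values.\<close>
  define \<phi> where "\<phi> = (\<lambda>(u, v). if l > 0 then u + v else u + (card Q div s' - v))"
  have key: "?h p = ?h p'" if "p \<le> p'" "\<phi> (?h p) = \<phi> (?h p')" for p p'
  proof -
    have a: "block P s p \<le> block P s p'" by (rule block_mono) (use fin that in auto)
    have b: "block Q s' (l * p + c) \<le> card Q div s'" "block Q s' (l * p' + c) \<le> card Q div s'"
      using fin by (simp_all add: block_le)
    show ?thesis
    proof (cases "l > 0")
      case True
      then have "block Q s' (l * p + c) \<le> block Q s' (l * p' + c)"
        by (intro block_mono) (use fin that in auto)
      with a that(2) True show ?thesis by (simp add: \<phi>_def)
    next
      case False
      then have "block Q s' (l * p' + c) \<le> block Q s' (l * p + c)"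
        by (intro block_mono) (use fin that in \<open>auto simp: mult_le_cancel_left\<close>)
      with a b that(2) False show ?thesis by (auto simp: \<phi>_def)
    qed
  qed
  have inj: "inj_on \<phi> (?h ` S)"
  proof (rule inj_onI)
    fix x y assume "x \<in> ?h ` S" "y \<in> ?h ` S" and e: "\<phi> x = \<phi> y"
    then obtain p p' where p: "x = ?h p" "y = ?h p'" by auto
    show "x = y"
    proof (cases "p \<le> p'")
      case True then show ?thesis using key[of p p'] e unfolding p by blast
    next
      case False then show ?thesis using key[of p' p] e unfolding p by (metis linear)
    qed
  qed
  have "\<phi> ` (?h ` S) \<subseteq> {..card P div s + card Q div s'}"
    using fin by (auto simp: \<phi>_def intro!: add_mono block_le)
  from card_inj_on_le[OF inj this] show ?thesis by simp
qed

text \<open>Each line contributes the number of cells it meets plus its colliding pairs. The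
  colliding pairs of all lines together are at most the pairs of grid points in a common cell, of
  which each grid point has at most \<open>s * s'\<close>.\<close>

lemma grid_incidences:
  assumes fin: "finite P" "finite Q" "finite L" and slope: "\<And>e. e \<in> L \<Longrightarrow> fst e \<noteq> 0"
    and s: "s > 0" "s' > 0"
  shows "(\<Sum>e\<in>L. line_inc P Q e)
    \<le> card L * (card P div s + card Q div s' + 1) + card P * card Q * (s * s')"
proof -
  define S where "S = (\<lambda>e. {p \<in> P. fst e * p + snd e \<in> Q})"
  define h where "h = (\<lambda>e p. (block P s p, block Q s' (fst e * p + snd e)))"
  define C where "C = (\<lambda>e. {(p, p'). p \<in> S e \<and> p' \<in> S e \<and> p \<noteq> p' \<and> h e p = h e p'})"
  have finS: "finite (S e)" for e using fin by (simp add: S_def)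
  have finC: "finite (C e)" for e
    by (rule finite_subset[of _ "S e \<times> S e"]) (use finS in \<open>auto simp: C_def\<close>)
  define T where "T = (SIGMA pq : P \<times> Q. {p \<in> P. block P s p = block P s (fst pq)} \<times>
      {q \<in> Q. block Q s' q = block Q s' (snd pq)})"
  have "line_inc P Q e \<le> (card P div s + card Q div s' + 1) + card (C e)" if "e \<in> L" for e
  proof -
    have "line_inc P Q e = card (S e)" by (simp add: line_inc_def S_def)
    also have "\<dots> \<le> card (h e ` S e) + card (C e)"
      unfolding C_def by (rule card_le_image_plus_collisions[OF finS])
    also have "card (h e ` S e) \<le> card P div s + card Q div s' + 1"
      unfolding h_def using slope[OF that] fin by (intro card_cells_on_line) (auto simp: S_def)
    finally show ?thesis by simp
  qed
  then have "(\<Sum>e\<in>L. line_inc P Q e) \<le> (\<Sum>e\<in>L. (card P div s + card Q div s' + 1) + card (C e))"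
    by (rule sum_mono)
  also have "\<dots> = card L * (card P div s + card Q div s' + 1) + card (Sigma L C)"
    using fin finC by (simp add: sum.distrib sum_Suc algebra_simps)
  \<comment> \<open>Two distinct points with different abscissae lie on only one line, so a pair of
    points in a cell is charged at most once.\<close>
  also have "card (Sigma L C) \<le> card T"
  proof (rule card_inj_on_le[where f = "\<lambda>(e, p, p'). ((p, fst e * p + snd e), (p', fst e * p' + snd e))"])
    show "inj_on (\<lambda>(e, p, p'). ((p, fst e * p + snd e), (p', fst e * p' + snd e))) (Sigma L C)"
    proof (rule inj_onI, clarsimp simp: C_def)
      fix l c l' c' p p' :: real
      assume ne: "p \<noteq> p'" and e: "l * p + c = l' * p + c'" "l * p' + c = l' * p' + c'"
      then have "(l - l') * (p - p') = 0" by (simp add: algebra_simps)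
      with ne have "l = l'" by simp
      with e show "l = l' \<and> c = c'" by simp
    qed
    show "(\<lambda>(e, p, p'). ((p, fst e * p + snd e), (p', fst e * p' + snd e))) ` Sigma L C \<subseteq> T"
      by (auto simp: C_def T_def S_def h_def)
    show "finite T" using fin by (auto simp: T_def)
  qed
  also have "card T = (\<Sum>pq\<in>P \<times> Q. card {p \<in> P. block P s p = block P s (fst pq)} *
      card {q \<in> Q. block Q s' q = block Q s' (snd pq)})"
    unfolding T_def using fin by (simp add: card_cartesian_product)
  also have "\<dots> \<le> (\<Sum>pq\<in>P \<times> Q. s * s')"
    using fin s by (intro sum_mono mult_le_mono card_block_le)
  finally show ?thesis using fin by (simp add: card_cartesian_product)
qed

text \<open>Optimising the block lengths in \<open>grid_incidences\<close> gives the
  Szemeredi-Trotter exponent. The term usually added for the number of points is absent, because a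
  line with nonzero slope has at most min(|P|, |Q|) incidences.\<close>

lemma grid_Szemeredi_Trotter:
  assumes fin: "finite P" "finite Q" "finite L" and slope: "\<And>e. e \<in> L \<Longrightarrow> fst e \<noteq> 0"
  shows "real (\<Sum>e\<in>L. line_inc P Q e)
    \<le> 6 * (real (card P) * real (card Q) * real (card L)) powr (2/3) + 6 * real (card L)"
proof (cases "P = {} \<or> Q = {} \<or> L = {}")
  case True
  then have "(\<Sum>e\<in>L. line_inc P Q e) = 0" by (auto simp: line_inc_def)
  then show ?thesis by (simp only:) simp
next
  case False
  define a b m I where "a = real (card P)" and "b = real (card Q)" and "m = real (card L)"
    and "I = real (\<Sum>e\<in>L. line_inc P Q e)"
  have pos: "a \<ge> 1" "b \<ge> 1" "m \<ge> 1"
    using False fin by (simp_all add: a_def b_def m_def Suc_leI card_gt_0_iff)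
  \<comment> \<open>With about \<open>r\<close> blocks per axis the two terms of the grid bound balance.\<close>
  define r where "r = (a\<^sup>2 * b\<^sup>2 / m) powr (1/3)"
  have r: "r > 0" using pos by (simp add: r_def)
  have r3: "r ^ 3 * m = a\<^sup>2 * b\<^sup>2"
  proof -
    have "r ^ 3 = r powr 3" using r by simp
    also have "\<dots> = a\<^sup>2 * b\<^sup>2 / m" using pos unfolding r_def powr_powr by simp
    finally have "r ^ 3 = a\<^sup>2 * b\<^sup>2 / m" .
    then show ?thesis using pos by simp
  qed
  have rm: "(a * b * m) powr (2/3) = r * m"
  proof -
    have "(a * b * m)\<^sup>2 = r ^ 3 * m * m\<^sup>2" unfolding r3 by (simp add: power_mult_distrib)
    also have "\<dots> = (r * m) ^ 3" by algebra
    finally have "(a * b * m)\<^sup>2 = (r * m) ^ 3" .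
    moreover have "a * b * m > 0" "r * m > 0" using pos r by simp_all
    ultimately have "(a * b * m) powr 2 = (r * m) powr 3" by simp
    then have "((a * b * m) powr 2) powr (1/3) = ((r * m) powr 3) powr (1/3)" by (rule arg_cong)
    then show ?thesis using \<open>r * m > 0\<close> unfolding powr_powr by simp
  qed
  have grid: "I \<le> m * (a / s + b / s' + 1) + a * b * (real s * real s')" if "s > 0" "s' > 0" for s s' :: nat
  proof -
    have "I \<le> real (card L * (card P div s + card Q div s' + 1) + card P * card Q * (s * s'))"
      unfolding I_def of_nat_le_iff by (rule grid_incidences) (use fin slope that in auto)
    also have "\<dots> = m * (real (card P div s) + real (card Q div s') + 1) + a * b * (real s * real s')"
      by (simp add: a_def b_def m_def algebra_simps)
    also have "\<dots> \<le> m * (a / s + b / s' + 1) + a * b * (real s * real s')"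
      unfolding a_def b_def using pos
      by (intro add_mono mult_left_mono of_nat_div_le_of_nat) auto
    finally show ?thesis .
  qed
  have triv: "I \<le> m * min a b"
  proof -
    have "line_inc P Q e \<le> min (card P) (card Q)" if "e \<in> L" for e
    proof -
      have "line_inc P Q e \<le> card Q"
        unfolding line_inc_def using fin slope[OF that]
        by (intro card_inj_on_le[where f = "\<lambda>p. fst e * p + snd e"]) (auto simp: inj_on_def)
      moreover have "line_inc P Q e \<le> card P"
        unfolding line_inc_def using fin by (intro card_mono) auto
      ultimately show ?thesis by simp
    qed
    then have "(\<Sum>e\<in>L. line_inc P Q e) \<le> (\<Sum>e\<in>L. min (card P) (card Q))" by (rule sum_mono)
    then have "I \<le> real (card L * min (card P) (card Q))" unfolding I_def of_nat_le_iff by simp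
    then show ?thesis by (simp add: a_def b_def m_def of_nat_min)
  qed
  have "I \<le> 6 * (r * m) + 6 * m"
  proof -
    \<comment> \<open>The number \<open>r\<close> of blocks per axis is only meaningful between 1
      and min(a, b). Below 1, taking each axis as one block leaves collisions worth at most
      \<open>m\<close>; above min(a, b), the trivial bound \<open>triv\<close> suffices.\<close>
    consider "r < 1" | "r \<ge> 1" "r > min a b" | "r \<ge> 1" "r \<le> min a b" by linarith
    then show ?thesis
    proof cases
      case 1
      have "I \<le> m * (a / a + b / b + 1) + a * b * (a * b)"
        using grid[of "card P" "card Q"] pos by (simp add: a_def b_def)
      also have "a * b * (a * b) = r ^ 3 * m" by (simp add: r3 power2_eq_square)
      also have "r ^ 3 * m \<le> 1 * m" using 1 r pos by (intro mult_right_mono power_le_one) auto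
      also have "m * (a / a + b / b + 1) = 3 * m" using pos by simp
      finally have "I \<le> 4 * m" by simp
      moreover have "r * m \<ge> 0" using r pos by simp
      ultimately show ?thesis using pos by linarith
    next
      case 2
      have "I \<le> m * min a b" by (rule triv)
      also have "\<dots> \<le> m * r" using 2 pos by (intro mult_left_mono) auto
      also have "\<dots> \<le> 6 * (r * m) + 6 * m" using pos r by simp
      finally show ?thesis .
    next
      case 3
      \<comment> \<open>Both quotients are at least 1 here, so rounding up at most doubles them; the
        collision term therefore grows by a factor of at most 4.\<close>
      define s s' where "s = nat \<lceil>a / r\<rceil>" and "s' = nat \<lceil>b / r\<rceil>"
      have ge: "a / r \<ge> 1" "b / r \<ge> 1" using 3 r by (simp_all add: field_simps)
      have s: "real s \<ge> a / r" "real s \<le> 2 * (a / r)" "real s' \<ge> b / r" "real s' \<le> 2 * (b / r)"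
        using ge unfolding s_def s'_def by linarith+
      have s0: "s > 0" "s' > 0" using s ge by linarith+
      have "I \<le> m * (a / s + b / s' + 1) + a * b * (real s * real s')" by (rule grid[OF s0])
      also have "\<dots> \<le> m * (r + r + 1) + a * b * ((2 * (a / r)) * (2 * (b / r)))"
      proof (intro add_mono mult_left_mono mult_mono)
        show "a / s \<le> r" "b / s' \<le> r" using s s0 r by (simp_all add: field_simps)
      qed (use s s0 pos r in auto)
      also have "a * b * ((2 * (a / r)) * (2 * (b / r))) = 4 * (a\<^sup>2 * b\<^sup>2) / r\<^sup>2"
        using r by (simp add: field_simps power2_eq_square)
      also have "\<dots> = 4 * (r * m)"
        unfolding r3[symmetric] using r by (simp add: field_simps power2_eq_square power3_eq_cube)
      finally show ?thesis using pos by (simp add: algebra_simps)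
    qed
  qed
  then show ?thesis unfolding I_def[symmetric] a_def[symmetric] b_def[symmetric] m_def[symmetric] rm .
qed

section \<open>Lines with slopes in a given set\<close>

definition rich_lines :: "real set \<Rightarrow> real set \<Rightarrow> nat \<Rightarrow> (real \<times> real) set" where
  "rich_lines A S k = {e. fst e \<in> S \<and> k \<le> line_inc A A e}"

definition harmonic_sum :: "nat \<Rightarrow> real" where
  "harmonic_sum m = (\<Sum>k = 1..m. 1 / real k)"

lemma line_inc_pos_imp:
  assumes "line_inc P Q e > 0"
  shows "\<exists>p\<in>P. \<exists>q\<in>Q. e = (fst e, q - fst e * p)"
proof -
  have "{p \<in> P. fst e * p + snd e \<in> Q} \<noteq> {}"
    using assms unfolding line_inc_def by (metis card.empty less_irrefl)
  then obtain p where "p \<in> P" "fst e * p + snd e \<in> Q" by auto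
  then show ?thesis
    by (intro bexI[of _ p] bexI[of _ "fst e * p + snd e"]) (auto simp: prod_eq_iff)
qed

text \<open>A line is determined by its slope and one grid point on it.\<close>

lemma finite_lines_meeting:
  assumes "finite P" "finite Q" "finite S"
  shows "finite {e. fst e \<in> S \<and> line_inc P Q e > 0}"
    and "card {e. fst e \<in> S \<and> line_inc P Q e > 0} \<le> card S * (card P * card Q)"
proof -
  let ?f = "\<lambda>(l, p, q). (l, q - l * p)"
  have sub: "{e. fst e \<in> S \<and> line_inc P Q e > 0} \<subseteq> ?f ` (S \<times> P \<times> Q)"
  proof
    fix e assume "e \<in> {e. fst e \<in> S \<and> line_inc P Q e > 0}"
    then have e: "fst e \<in> S" "line_inc P Q e > 0" by auto
    from line_inc_pos_imp[OF e(2)] obtain p q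
      where "p \<in> P" "q \<in> Q" "e = (fst e, q - fst e * p)" by blast
    with e(1) show "e \<in> ?f ` (S \<times> P \<times> Q)"
      by (intro image_eqI[of _ _ "(fst e, p, q)"]) auto
  qed
  show "finite {e. fst e \<in> S \<and> line_inc P Q e > 0}"
    by (rule finite_subset[OF sub]) (use assms in auto)
  have "card {e. fst e \<in> S \<and> line_inc P Q e > 0} \<le> card (?f ` (S \<times> P \<times> Q))"
    by (rule card_mono[OF _ sub]) (use assms in auto)
  also have "\<dots> \<le> card (S \<times> P \<times> Q)" by (rule card_image_le) (use assms in auto)
  finally show "card {e. fst e \<in> S \<and> line_inc P Q e > 0} \<le> card S * (card P * card Q)"
    by (simp add: card_cartesian_product)
qed

lemma finite_rich_lines:
  assumes "finite A" "finite S" "k > 0"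
  shows "finite (rich_lines A S k)"
  by (rule finite_subset[OF _ finite_lines_meeting(1)[of A A S]])
     (use assms in \<open>auto simp: rich_lines_def\<close>)

text \<open>Lines of equal slope are disjoint, so each slope in \<open>S\<close> uses every point of
  A x A at most once. This is double counting of incidences.\<close>

lemma card_rich_lines_le:
  assumes "finite A" "finite S" "k > 0"
  shows "k * card (rich_lines A S k) \<le> card S * (card A)\<^sup>2"
proof -
  let ?T = "Sigma (rich_lines A S k) (\<lambda>e. {a \<in> A. fst e * a + snd e \<in> A})"
  have "k * card (rich_lines A S k) = (\<Sum>e\<in>rich_lines A S k. k)" by simp
  also have "\<dots> \<le> (\<Sum>e\<in>rich_lines A S k. line_inc A A e)"
    by (rule sum_mono) (simp add: rich_lines_def)
  also have "\<dots> = card ?T"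
    using assms finite_rich_lines[OF assms] by (subst card_SigmaI) (auto simp: line_inc_def)
  also have "\<dots> \<le> card (S \<times> A \<times> A)"
    by (rule card_inj_on_le[where f = "\<lambda>(e, a). (fst e, a, fst e * a + snd e)"])
       (use assms in \<open>auto simp: inj_on_def rich_lines_def\<close>)
  finally show ?thesis by (simp add: card_cartesian_product power2_eq_square)
qed

text \<open>The rich-lines form of Szemeredi-Trotter. For \<open>k < 12\<close> the trivial count
  \<open>mk\<close> is enough; otherwise the incidence bound is solved for the number of
  lines.\<close>

lemma card_rich_lines_cube:
  assumes fin: "finite A" "finite S" and k: "k > 0" and S: "0 \<notin> S" "card S \<le> (card A)\<^sup>2"
  shows "real (card (rich_lines A S k)) * real k ^ 3 \<le> 1728 * real (card A) ^ 4"
proof -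
  define m n where "m = real (card (rich_lines A S k))" and "n = real (card A)"
  have m0: "m \<ge> 0" by (simp add: m_def)
  have mk: "real k * m \<le> n ^ 4"
  proof -
    have "k * card (rich_lines A S k) \<le> card S * (card A)\<^sup>2" by (rule card_rich_lines_le[OF fin k])
    also have "\<dots> \<le> (card A)\<^sup>2 * (card A)\<^sup>2" by (rule mult_le_mono1[OF S(2)])
    also have "\<dots> = card A ^ 4" by (simp flip: power_add)
    finally have "real (k * card (rich_lines A S k)) \<le> real (card A ^ 4)" by (rule of_nat_mono)
    then show ?thesis by (simp add: m_def n_def)
  qed
  show ?thesis
  proof (cases "k < 12 \<or> m = 0")
    case True
    then show ?thesis
    proof
      assume "k < 12"
      have "m * real k ^ 3 = (real k * m) * real k ^ 2" by (simp add: power2_eq_square power3_eq_cube)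
      also have "\<dots> \<le> n ^ 4 * 12 ^ 2"
        using \<open>k < 12\<close> mk by (intro mult_mono power_mono) auto
      also have "\<dots> \<le> 1728 * n ^ 4" by simp
      finally show ?thesis by (simp add: m_def n_def)
    next
      assume "m = 0"
      then show ?thesis by (simp add: m_def)
    qed
  next
    case False
    then have k12: "real k \<ge> 12" and m: "m > 0" using m0 by auto
    have "real k * m \<le> real (\<Sum>e\<in>rich_lines A S k. line_inc A A e)"
    proof -
      have "k * card (rich_lines A S k) = (\<Sum>e\<in>rich_lines A S k. k)" by simp
      also have "\<dots> \<le> (\<Sum>e\<in>rich_lines A S k. line_inc A A e)"
        by (rule sum_mono) (simp add: rich_lines_def)
      finally show ?thesis unfolding m_def of_nat_mult[symmetric] of_nat_le_iff .
    qed
    also have "\<dots> \<le> 6 * (n * n * m) powr (2/3) + 6 * m"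
      unfolding m_def n_def using fin S(1) finite_rich_lines[OF fin k]
      by (intro grid_Szemeredi_Trotter) (auto simp: rich_lines_def)
    finally have "real k * m \<le> 6 * (n * n * m) powr (2/3) + 6 * m" .
    \<comment> \<open>As \<open>k\<close> is at least 12, the linear term \<open>6 * m\<close> is at
      most half of \<open>k * m\<close> and can be absorbed. Doubling the main term yields 12, whose
      cube is 1728.\<close>
    moreover have "12 * m \<le> real k * m" using k12 m by (intro mult_right_mono) auto
    ultimately have le: "real k * m \<le> 12 * (n * n * m) powr (2/3)" by linarith
    have n: "n * n * m > 0"
    proof -
      have "n \<noteq> 0" using mk m k by (auto simp: mult_le_0_iff)
      then show ?thesis using m by (simp add: zero_less_mult_iff n_def)
    qed
    have "((n * n * m) powr (2/3)) ^ 3 = ((n * n * m) powr (2/3)) powr 3"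
      using n by simp
    also have "\<dots> = (n * n * m) ^ 2" unfolding powr_powr using n by simp
    finally have cube: "((n * n * m) powr (2/3)) ^ 3 = (n * n * m) ^ 2" .
    have "(real k * m) ^ 3 \<le> (12 * (n * n * m) powr (2/3)) ^ 3"
      using le m by (intro power_mono) auto
    also have "\<dots> = 1728 * (n * n * m) ^ 2" unfolding power_mult_distrib[of 12] cube by simp
    finally have "m\<^sup>2 * (m * real k ^ 3) \<le> m\<^sup>2 * (1728 * n ^ 4)"
      by (simp add: power_mult_distrib power2_eq_square power3_eq_cube power4_eq_xxxx mult_ac)
    then have "m * real k ^ 3 \<le> 1728 * n ^ 4"
      using m by (subst (asm) mult_le_cancel_left_pos) auto
    then show ?thesis by (simp add: m_def n_def)
  qed
qed

lemma powr_power6: "x > 0 \<Longrightarrow> (x powr a) ^ 6 = x powr (6 * a)" for x a :: real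
  by (simp add: powr_power mult.commute)

text \<open>Szemeredi-Trotter is applied to lines that are rich in A x A, but against a second grid
  D1 x D2. The decay 1/k is what makes the later sum over the richness \<open>k\<close> cost only a
  logarithm.\<close>

lemma line_inc_rich_lines:
  assumes fin: "finite A" "finite S" "finite D1" "finite D2"
    and k: "k > 0" and S: "0 \<notin> S" "card S \<le> (card A)\<^sup>2"
  shows "real (\<Sum>e\<in>rich_lines A S k. line_inc D1 D2 e)
    \<le> 96 * real (card A) powr (5/3) * real (card S) powr (1/2)
        * (real (card D1) * real (card D2)) powr (2/3) / real k"
proof -
  \<comment> \<open>Lines missing D1 x D2 carry no incidences. Dropping them makes the bound
    \<open>mwD\<close> available, which is needed to control the linear term.\<close>
  define L where "L = {e \<in> rich_lines A S k. line_inc D1 D2 e > 0}"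
  define m n w D where "m = real (card L)" and "n = real (card A)" and "w = real (card S)"
    and "D = real (card D1) * real (card D2)"
  have finR: "finite (rich_lines A S k)" by (rule finite_rich_lines) (use fin k in auto)
  have finL: "finite L" using finR by (simp add: L_def)
  have sumL: "(\<Sum>e\<in>rich_lines A S k. line_inc D1 D2 e) = (\<Sum>e\<in>L. line_inc D1 D2 e)"
    unfolding L_def using finR by (intro sum.mono_neutral_right) auto
  show ?thesis
  proof (cases "L = {}")
    case True
    then show ?thesis unfolding sumL by simp
  next
    case False
    have LR: "card L \<le> card (rich_lines A S k)" by (intro card_mono finR) (auto simp: L_def)
    have m: "m \<ge> 1" using False finL by (simp add: m_def Suc_leI card_gt_0_iff)
    have mk: "real k * m \<le> w * n\<^sup>2"
    proof -
      have "k * card L \<le> card S * (card A)\<^sup>2"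
        using card_rich_lines_le[OF fin(1,2) k] LR by (meson le_trans mult_le_mono2)
      then have "real (k * card L) \<le> real (card S * (card A)\<^sup>2)" by (rule of_nat_mono)
      then show ?thesis by (simp add: m_def n_def w_def)
    qed
    have mk3: "m * real k ^ 3 \<le> 1728 * n ^ 4"
    proof -
      have "m * real k ^ 3 \<le> real (card (rich_lines A S k)) * real k ^ 3"
        using LR by (intro mult_right_mono) (auto simp: m_def)
      also have "\<dots> \<le> 1728 * n ^ 4" unfolding n_def by (rule card_rich_lines_cube) (use fin k S in auto)
      finally show ?thesis .
    qed
    have mwD: "m \<le> w * D"
    proof -
      have "card L \<le> card {e. fst e \<in> S \<and> line_inc D1 D2 e > 0}"
        by (intro card_mono finite_lines_meeting fin) (auto simp: L_def rich_lines_def)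
      also have "\<dots> \<le> card S * (card D1 * card D2)"
        by (rule finite_lines_meeting) (use fin in auto)
      finally have "real (card L) \<le> real (card S * (card D1 * card D2))" by (rule of_nat_mono)
      then show ?thesis by (simp add: m_def w_def D_def)
    qed
    have wn: "w \<le> n\<^sup>2" using S(2) unfolding w_def n_def by (metis of_nat_le_iff of_nat_power)
    have "w * D > 0" using mwD m by linarith
    then have w: "w > 0" and D: "D > 0" by (auto simp: w_def D_def zero_less_mult_iff)
    have n: "n > 0" using wn w by (auto simp: n_def intro: ccontr)
    define U where "U = n powr (5/3) * w powr (1/2)"
    \<comment> \<open>Sixth powers clear the denominators of all exponents 5/3, 1/2 and 2/3 at
      once.\<close>
    have U6: "U ^ 6 = n ^ 10 * w ^ 3" and U: "U > 0"
      using n w by (simp_all add: U_def power_mult_distrib powr_power6)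
    have D6: "(D powr (2/3)) ^ 6 = D ^ 4" using D by (simp add: powr_power6)
    have m6: "(m powr (2/3)) ^ 6 = m ^ 4" using m by (simp add: powr_power6)
    \<comment> \<open>Both terms of Szemeredi-Trotter for \<open>L\<close> are interpolated between the three bounds
      \<open>mk\<close>, \<open>mk3\<close>, \<open>mwD\<close> so that each gives the same power of \<open>w\<close>, \<open>n\<close> and \<open>D\<close>.\<close>
    have first: "m powr (2/3) * real k \<le> 4 * U"
    proof (rule power_le_imp_le_base)
      have "(m powr (2/3) * real k) ^ Suc 5 = (real k * m) ^ 3 * (m * real k ^ 3)"
        by (simp add: power_mult_distrib m6) (simp add: power_numeral_reduce)
      also have "\<dots> \<le> (w * n\<^sup>2) ^ 3 * (1728 * n ^ 4)"
        by (intro mult_mono power_mono mk mk3) (use m w n in auto)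
      also have "\<dots> = 1728 * (n ^ 10 * w ^ 3)" by (simp add: power_mult_distrib flip: power_mult power_add)
      also have "\<dots> \<le> 4096 * (n ^ 10 * w ^ 3)" using n w by (intro mult_right_mono) auto
      also have "\<dots> = (4 * U) ^ Suc 5" by (simp add: power_mult_distrib U6)
      finally show "(m powr (2/3) * real k) ^ Suc 5 \<le> (4 * U) ^ Suc 5" .
    qed (use U in simp)
    have second: "m * real k \<le> 12 * (U * D powr (2/3))"
    proof (rule power_le_imp_le_base)
      have "(m * real k) ^ Suc 5 = m ^ 4 * (m * real k ^ 3) ^ 2"
        by (simp add: power_mult_distrib flip: power_mult power_Suc power_add)
      also have "\<dots> \<le> (w * D) ^ 4 * (1728 * n ^ 4) ^ 2"
        by (intro mult_mono power_mono mwD mk3) (use m w D n in auto)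
      also have "\<dots> = w * (1728\<^sup>2 * n ^ 8 * w ^ 3 * D ^ 4)"
        by (simp add: power_mult_distrib power_numeral_reduce)
      \<comment> \<open>The interpolation leaves one factor \<open>w\<close> too many; it is traded
        for two factors \<open>n\<close> through \<open>wn\<close>.\<close>
      also have "\<dots> \<le> n\<^sup>2 * (1728\<^sup>2 * n ^ 8 * w ^ 3 * D ^ 4)"
        using wn n w D by (intro mult_right_mono) auto
      also have "\<dots> = 12 ^ 6 * ((n ^ 10 * w ^ 3) * D ^ 4)"
        by (simp add: power_numeral_reduce)
      also have "\<dots> = (12 * (U * D powr (2/3))) ^ Suc 5"
        by (simp add: power_mult_distrib U6 D6)
      finally show "(m * real k) ^ Suc 5 \<le> (12 * (U * D powr (2/3))) ^ Suc 5" .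
    qed (use U in simp)
    have "real (\<Sum>e\<in>L. line_inc D1 D2 e)
        \<le> 6 * (real (card D1) * real (card D2) * real (card L)) powr (2/3) + 6 * real (card L)"
      using fin finL S(1) by (intro grid_Szemeredi_Trotter) (auto simp: L_def rich_lines_def)
    also have "\<dots> = 6 * (D powr (2/3) * m powr (2/3)) + 6 * m"
      using D m by (simp add: D_def[symmetric] m_def[symmetric] powr_mult)
    also have "\<dots> \<le> 6 * (D powr (2/3) * (4 * U / k)) + 6 * (12 * (U * D powr (2/3)) / k)"
      using first second k by (intro add_mono mult_left_mono) (simp_all add: pos_le_divide_eq)
    also have "6 * (D powr (2/3) * (4 * U / k)) + 6 * (12 * (U * D powr (2/3)) / k)
        = 96 * U * D powr (2/3) / k"
      by (simp add: field_simps)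
    finally show ?thesis unfolding sumL U_def n_def w_def D_def by (simp add: mult_ac)
  qed
qed

text \<open>Geometrically, a point of A x A and a point of D1 x D2 on a common line whose slope lies
  in \<open>S\<close>.\<close>

definition parallel_pairs :: "real set \<Rightarrow> real set \<Rightarrow> real set \<Rightarrow> real set \<Rightarrow>
    (real \<times> (real \<times> real) \<times> (real \<times> real)) set" where
  "parallel_pairs A S D1 D2 = {(l, (a1, a2), (d1, d2)). l \<in> S \<and> a1 \<in> A \<and> a2 \<in> A \<and>
      d1 \<in> D1 \<and> d2 \<in> D2 \<and> a2 - d2 = l * (a1 - d1)}"

text \<open>Grouping by the common line gives a sum of products of its incidences with the two
  grids. Splitting the incidences with A x A by thresholds \<open>k\<close> leaves the incidences of
  the k-rich lines with D1 x D2, and their bounds add up to a harmonic sum.\<close>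

lemma card_parallel_pairs_le:
  assumes fin: "finite A" "finite S" "finite D1" "finite D2"
    and S: "0 \<notin> S" "card S \<le> (card A)\<^sup>2"
  shows "real (card (parallel_pairs A S D1 D2))
    \<le> 96 * harmonic_sum (card A) * real (card A) powr (5/3) * real (card S) powr (1/2)
        * (real (card D1) * real (card D2)) powr (2/3)"
proof -
  let ?n = "card A"
  let ?R = "rich_lines A S"
  have fR: "finite (?R 1)" using fin by (intro finite_rich_lines) auto
  let ?T = "Sigma (?R 1) (\<lambda>e. {a \<in> A. fst e * a + snd e \<in> A} \<times> {d \<in> D1. fst e * d + snd e \<in> D2})"
  have line_le: "line_inc A A e \<le> ?n" for e
    unfolding line_inc_def by (intro card_mono fin) auto
  have fT: "finite ?T" using fin fR by (intro finite_SigmaI) auto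
  have "card (parallel_pairs A S D1 D2) \<le> card ?T"
  proof (rule card_inj_on_le[OF _ _ fT])
    let ?f = "\<lambda>(l, (a1, a2), (d1, d2)). ((l, a2 - l * a1), (a1, d1)) :: (real \<times> real) \<times> (real \<times> real)"
    show "inj_on ?f (parallel_pairs A S D1 D2)"
      by (auto simp: inj_on_def parallel_pairs_def algebra_simps)
    show "?f ` parallel_pairs A S D1 D2 \<subseteq> ?T"
    proof (clarsimp simp: parallel_pairs_def rich_lines_def, intro conjI)
      fix l a1 a2 d1 d2 assume *: "l \<in> S" "a1 \<in> A" "a2 \<in> A" "d1 \<in> D1" "d2 \<in> D2"
        and e: "a2 - d2 = l * (a1 - d1)"
      have "{a \<in> A. l * a + (a2 - l * a1) \<in> A} \<noteq> {}" using * by auto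
      then show "Suc 0 \<le> line_inc A A (l, a2 - l * a1)"
        using fin by (simp add: line_inc_def Suc_le_eq card_gt_0_iff)
      have "l * d1 + (a2 - l * a1) = d2" using e by (simp add: algebra_simps)
      then show "l * d1 + (a2 - l * a1) \<in> D2" using * by simp
    qed
  qed
  also have "card ?T = (\<Sum>e\<in>?R 1. line_inc A A e * line_inc D1 D2 e)"
    using fin fR by (subst card_SigmaI) (auto simp: line_inc_def card_cartesian_product)
  \<comment> \<open>The incidence number with A x A is written as the number of thresholds
    \<open>k\<close> that it reaches.\<close>
  also have "\<dots> = (\<Sum>e\<in>?R 1. \<Sum>k = 1..?n. if k \<le> line_inc A A e then line_inc D1 D2 e else 0)"
  proof (rule sum.cong[OF refl])
    fix e
    have "{1..?n} \<inter> {k. k \<le> line_inc A A e} = {1..line_inc A A e}" using line_le[of e] by auto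
    then show "line_inc A A e * line_inc D1 D2 e
        = (\<Sum>k = 1..?n. if k \<le> line_inc A A e then line_inc D1 D2 e else 0)"
      by (simp add: sum.If_cases)
  qed
  also have "\<dots> = (\<Sum>k = 1..?n. \<Sum>e\<in>?R 1. if k \<le> line_inc A A e then line_inc D1 D2 e else 0)"
    by (rule sum.swap)
  also have "\<dots> = (\<Sum>k = 1..?n. \<Sum>e\<in>?R k. line_inc D1 D2 e)"
  proof (rule sum.cong[OF refl])
    fix k assume "k \<in> {1..?n}"
    then have "?R 1 \<inter> {e. k \<le> line_inc A A e} = ?R k" by (auto simp: rich_lines_def)
    then show "(\<Sum>e\<in>?R 1. if k \<le> line_inc A A e then line_inc D1 D2 e else 0)
        = (\<Sum>e\<in>?R k. line_inc D1 D2 e)"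
      using fR by (simp add: sum.If_cases)
  qed
  finally have "real (card (parallel_pairs A S D1 D2))
      \<le> real (\<Sum>k = 1..?n. \<Sum>e\<in>?R k. line_inc D1 D2 e)"
    by (rule of_nat_mono)
  also have "\<dots> = (\<Sum>k = 1..?n. real (\<Sum>e\<in>?R k. line_inc D1 D2 e))" by simp
  also have "\<dots> \<le> (\<Sum>k = 1..?n. 96 * real ?n powr (5/3) * real (card S) powr (1/2)
        * (real (card D1) * real (card D2)) powr (2/3) / real k)"
    by (intro sum_mono line_inc_rich_lines fin S) auto
  also have "\<dots> = 96 * harmonic_sum (card A) * real (card A) powr (5/3) * real (card S) powr (1/2)
        * (real (card D1) * real (card D2)) powr (2/3)"
    by (simp add: harmonic_sum_def sum_distrib_left sum_distrib_right mult_ac)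
  finally show ?thesis .
qed

section \<open>Weighted multiplicative energy\<close>

text \<open>The increments of the square are 2t - 1, which is at most 2t.\<close>

lemma square_le_sum_levels:
  fixes r N :: nat
  assumes "r \<le> N"
  shows "r\<^sup>2 \<le> (\<Sum>t = 1..N. if t \<le> r then 2 * t else 0)"
proof -
  have "{1..N} \<inter> {t. t \<le> r} = {1..r}" using assms by auto
  then have "(\<Sum>t = 1..N. if t \<le> r then 2 * t else 0) = (\<Sum>t = 1..r. 2 * t)"
    by (simp add: sum.If_cases)
  moreover have "r\<^sup>2 \<le> (\<Sum>t = 1..r. 2 * t)"
    by (induction r) (auto simp: power2_eq_square)
  ultimately show ?thesis by simp
qed

text \<open>Markov's inequality for the cubes, raised to the power 2/3. The remaining 1/t sums to a
  harmonic sum over the thresholds.\<close>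

lemma level_set_weak_bound:
  fixes \<rho> :: "real \<Rightarrow> nat"
  assumes "finite D" "t > 0"
  shows "real t * real (card {d \<in> D. t \<le> \<rho> d}) powr (2/3)
    \<le> real (\<Sum>d\<in>D. \<rho> d ^ 3) powr (2/3) / real t"
proof -
  let ?L = "{d \<in> D. t \<le> \<rho> d}"
  have "t ^ 3 * card ?L = (\<Sum>d\<in>?L. t ^ 3)" by simp
  also have "\<dots> \<le> (\<Sum>d\<in>?L. \<rho> d ^ 3)" by (intro sum_mono power_mono) auto
  also have "\<dots> \<le> (\<Sum>d\<in>D. \<rho> d ^ 3)" using assms by (intro sum_mono2) auto
  finally have "real (t ^ 3 * card ?L) \<le> real (\<Sum>d\<in>D. \<rho> d ^ 3)" by (rule of_nat_mono)
  then have "(real t ^ 3 * real (card ?L)) powr (2/3) \<le> real (\<Sum>d\<in>D. \<rho> d ^ 3) powr (2/3)"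
    by (intro powr_mono2) auto
  moreover have "(real t ^ 3 * real (card ?L)) powr (2/3) = (real t ^ 3) powr (2/3) * real (card ?L) powr (2/3)"
    by (rule powr_mult)
  moreover have "(real t ^ 3) powr (2/3) = (real t)\<^sup>2"
  proof -
    have "(real t ^ 3) powr (2/3) = (real t powr 3) powr (2/3)" using assms(2) by simp
    also have "\<dots> = real t powr 2" unfolding powr_powr by simp
    finally show ?thesis using assms(2) by simp
  qed
  ultimately show ?thesis using assms(2) by (simp add: field_simps power2_eq_square)
qed

text \<open>Expanding both weights gives a sum over y, l*y in \<open>Y\<close> and a, b in
  \<open>A\<close>. Splitting the two squared values of \<rho> by thresholds reduces it to counting
  parallel pairs whose second point lies in a product of level sets.\<close>

lemma weighted_ratio_count:
  fixes \<rho> :: "real \<Rightarrow> nat" and f :: "real \<Rightarrow> nat"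
  assumes fin: "finite A" "finite S" "finite D"
    and S: "0 \<notin> S" "card S \<le> (card A)\<^sup>2"
    and Y: "Y \<subseteq> A" and D: "\<And>a b. a \<in> A \<Longrightarrow> b \<in> A \<Longrightarrow> a - b \<in> D"
    and \<rho>: "\<And>d. \<rho> d \<le> N"
    and f: "\<And>y. f y = (\<Sum>a\<in>A. \<rho> (a - y) ^ 2)"
  shows "real (\<Sum>(l, y) \<in> (SIGMA l : S. {y \<in> Y. l * y \<in> Y}). f y * f (l * y))
    \<le> 384 * harmonic_sum (card A) * harmonic_sum N ^ 2 * real (card A) powr (5/3)
        * real (card S) powr (1/2) * real (\<Sum>d\<in>D. \<rho> d ^ 3) powr (4/3)"
proof -
  define V where "V = (SIGMA l : S. {y \<in> Y. l * y \<in> Y})"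
  define Dt where "Dt = (\<lambda>t. {d \<in> D. t \<le> \<rho> d})"
  define Z where "Z = V \<times> (A \<times> A)"
  define c where "c = (\<lambda>t d. if t \<le> \<rho> d then 2 * t else 0)"
  define G where "G = real (\<Sum>d\<in>D. \<rho> d ^ 3)"
  have finY: "finite Y" using fin Y by (rule_tac finite_subset)
  have finZ: "finite Z" using fin finY by (auto simp: Z_def V_def)
  have finDt: "finite (Dt t)" for t using fin by (simp add: Dt_def)
  have "(\<Sum>(l, y)\<in>V. f y * f (l * y))
      = (\<Sum>((l, y), (a, b)) \<in> Z. \<rho> (a - y) ^ 2 * \<rho> (b - l * y) ^ 2)"
    unfolding Z_def f by (simp add: case_prod_unfold sum_product sum.cartesian_product)
  also have "\<dots> \<le> (\<Sum>((l, y), (a, b)) \<in> Z. (\<Sum>s = 1..N. c s (a - y)) * (\<Sum>t = 1..N. c t (b - l * y)))"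
    unfolding c_def by (rule sum_mono, clarify, intro mult_le_mono square_le_sum_levels \<rho>)
  also have "\<dots> = (\<Sum>z\<in>Z. \<Sum>(s, t)\<in>{1..N} \<times> {1..N}. case z of ((l, y), (a, b)) \<Rightarrow> c s (a - y) * c t (b - l * y))"
    by (simp add: case_prod_unfold sum_product sum.cartesian_product)
  also have "\<dots> = (\<Sum>(s, t)\<in>{1..N} \<times> {1..N}. \<Sum>z\<in>Z. case z of ((l, y), (a, b)) \<Rightarrow> c s (a - y) * c t (b - l * y))"
    unfolding case_prod_unfold by (rule sum.swap)
  also have "\<dots> \<le> (\<Sum>(s, t)\<in>{1..N} \<times> {1..N}. (2 * s) * (2 * t) * card (parallel_pairs A S (Dt s) (Dt t)))"
  proof (rule sum_mono, clarify)
    fix s t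
    let ?Z = "{((l, y), (a, b)). ((l, y), (a, b)) \<in> Z \<and> s \<le> \<rho> (a - y) \<and> t \<le> \<rho> (b - l * y)}"
    have "(\<Sum>z\<in>Z. case z of ((l, y), (a, b)) \<Rightarrow> c s (a - y) * c t (b - l * y))
        = (\<Sum>z\<in>Z. if z \<in> ?Z then (2 * s) * (2 * t) else 0)"
      by (intro sum.cong refl) (auto simp: c_def split: if_splits)
    also have "\<dots> = (2 * s) * (2 * t) * card ?Z"
    proof -
      have "Z \<inter> ?Z = ?Z" by auto
      then show ?thesis using finZ by (simp add: sum.If_cases)
    qed
    \<comment> \<open>The points (a, b) and (a - y, b - l*y) differ by (y, l*y), a vector of slope
      \<open>l\<close>; the pair of points still determines \<open>y\<close>.\<close>
    also have "card ?Z \<le> card (parallel_pairs A S (Dt s) (Dt t))"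
    proof (rule card_inj_on_le)
      let ?g = "\<lambda>((l, y), (a, b)). (l, (a, b), (a - y, b - l * y)) :: real \<times> (real \<times> real) \<times> (real \<times> real)"
      show "inj_on ?g ?Z" by (auto simp: inj_on_def)
      show "?g ` ?Z \<subseteq> parallel_pairs A S (Dt s) (Dt t)"
        using Y D by (auto simp: parallel_pairs_def Z_def V_def Dt_def algebra_simps)
      show "finite (parallel_pairs A S (Dt s) (Dt t))"
        by (rule finite_subset[of _ "S \<times> (A \<times> A) \<times> (Dt s \<times> Dt t)"])
           (use fin finDt in \<open>auto simp: parallel_pairs_def\<close>)
    qed
    finally show "(\<Sum>z\<in>Z. case z of ((l, y), (a, b)) \<Rightarrow> c s (a - y) * c t (b - l * y))
        \<le> (2 * s) * (2 * t) * card (parallel_pairs A S (Dt s) (Dt t))" by simp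
  qed
  finally have "real (\<Sum>(l, y)\<in>V. f y * f (l * y))
      \<le> real (\<Sum>(s, t)\<in>{1..N} \<times> {1..N}. (2 * s) * (2 * t) * card (parallel_pairs A S (Dt s) (Dt t)))"
    by (rule of_nat_mono)
  also have "\<dots> = (\<Sum>(s, t)\<in>{1..N} \<times> {1..N}. (2 * real s) * (2 * real t)
      * real (card (parallel_pairs A S (Dt s) (Dt t))))"
    by (simp add: case_prod_unfold)
  also have "\<dots> \<le> (\<Sum>(s, t)\<in>{1..N} \<times> {1..N}. (2 * real s) * (2 * real t)
      * (96 * harmonic_sum (card A) * real (card A) powr (5/3) * real (card S) powr (1/2)
        * (real (card (Dt s)) * real (card (Dt t))) powr (2/3)))"
    by (rule sum_mono, clarify, intro mult_left_mono card_parallel_pairs_le fin S finDt) simp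
  \<comment> \<open>The bound depends on the two thresholds through a product, so the double sum is
    a square.\<close>
  also have "\<dots> = 96 * harmonic_sum (card A) * real (card A) powr (5/3) * real (card S) powr (1/2)
      * (\<Sum>t = 1..N. 2 * (real t * real (card (Dt t)) powr (2/3))) ^ 2"
    unfolding power2_eq_square sum_product unfolding sum.cartesian_product unfolding sum_distrib_left
    by (intro sum.cong refl) (auto simp: powr_mult)
  also have "\<dots> \<le> 96 * harmonic_sum (card A) * real (card A) powr (5/3) * real (card S) powr (1/2)
      * (2 * G powr (2/3) * harmonic_sum N) ^ 2"
  proof (intro mult_left_mono power_mono)
    have "(\<Sum>t = 1..N. 2 * (real t * real (card (Dt t)) powr (2/3))) \<le> (\<Sum>t = 1..N. 2 * (G powr (2/3) / real t))"
      unfolding Dt_def G_def using fin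
      by (intro sum_mono mult_left_mono level_set_weak_bound) auto
    also have "\<dots> = 2 * G powr (2/3) * harmonic_sum N"
      by (simp add: harmonic_sum_def sum_distrib_left)
    finally show "(\<Sum>t = 1..N. 2 * (real t * real (card (Dt t)) powr (2/3))) \<le> 2 * G powr (2/3) * harmonic_sum N" .
  qed (auto intro!: sum_nonneg mult_nonneg_nonneg simp: harmonic_sum_def)
  \<comment> \<open>The factor 4 turns 96 into 384, and the two level sets together give the
    exponent 4/3.\<close>
  also have "(2 * G powr (2/3) * harmonic_sum N) ^ 2 = 4 * (harmonic_sum N ^ 2 * G powr (4/3))"
  proof -
    have "(G powr (2/3)) ^ 2 = G powr (4/3)"
      by (simp add: power2_eq_square flip: powr_add)
    then show ?thesis by (simp add: power_mult_distrib)
  qed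
  finally show ?thesis unfolding V_def G_def by (simp add: mult_ac)
qed

text \<open>A multiplicative quadruple is recorded by the ratio l = y3/y1 = y2/y4 together with y1
  and y4. The energy is thus at most the sum over ratios of squared multiplicities, which is then
  split into levels.\<close>

lemma Emult_level_bound:
  assumes fin: "finite Y" and Y: "0 \<notin> Y" "card Y \<le> n"
  defines "L \<equiv> \<lambda>k. {l \<in> (\<lambda>(y, z). z / y) ` (Y \<times> Y). k \<le> card {y \<in> Y. l * y \<in> Y}}"
  shows "Emult Y \<le> (\<Sum>k = 1..n. 2 * k * card (L k))"
proof -
  let ?R = "(\<lambda>(y, z). z / y) ` (Y \<times> Y)" and ?r = "\<lambda>l. card {y \<in> Y. l * y \<in> Y}"
  let ?T = "Sigma ?R (\<lambda>l. {y \<in> Y. l * y \<in> Y} \<times> {y \<in> Y. l * y \<in> Y})"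
  have "Emult Y \<le> card ?T"
    unfolding Emult_def
  proof (rule card_inj_on_le[where f = "\<lambda>(y1, y2, y3, y4). (y3 / y1, y1, y4)"])
    show "inj_on (\<lambda>(y1, y2, y3, y4). (y3 / y1, y1, y4))
        {(y1, y2, y3, y4). y1 \<in> Y \<and> y2 \<in> Y \<and> y3 \<in> Y \<and> y4 \<in> Y \<and> y1 * y2 = y3 * y4}"
      using Y by (auto simp: inj_on_def) (metis mult_left_cancel)
    show "(\<lambda>(y1, y2, y3, y4). (y3 / y1, y1, y4)) `
        {(y1, y2, y3, y4). y1 \<in> Y \<and> y2 \<in> Y \<and> y3 \<in> Y \<and> y4 \<in> Y \<and> y1 * y2 = y3 * y4} \<subseteq> ?T"
    proof (rule image_subsetI)
      fix x assume "x \<in> {(y1, y2, y3, y4). y1 \<in> Y \<and> y2 \<in> Y \<and> y3 \<in> Y \<and> y4 \<in> Y \<and> y1 * y2 = y3 * y4}"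
      then obtain y1 y2 y3 y4 where x: "x = (y1, y2, y3, y4)"
        and y: "y1 \<in> Y" "y2 \<in> Y" "y3 \<in> Y" "y4 \<in> Y" and e: "y1 * y2 = y3 * y4" by auto
      have "y1 \<noteq> 0" using y Y by auto
      then have "y3 / y1 * y4 = y2" "y3 / y1 * y1 = y3" using e by (simp_all add: field_simps)
      moreover have "y3 / y1 \<in> ?R" using y by force
      ultimately show "(case x of (y1, y2, y3, y4) \<Rightarrow> (y3 / y1, y1, y4)) \<in> ?T"
        using y unfolding x by (simp only: prod.case mem_Sigma_iff mem_Collect_eq)
    qed
    show "finite ?T" using fin by (intro finite_SigmaI) auto
  qed
  also have "card ?T = (\<Sum>l\<in>?R. (?r l)\<^sup>2)"
    using fin by (subst card_SigmaI) (auto simp: card_cartesian_product power2_eq_square)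
  also have "\<dots> \<le> (\<Sum>l\<in>?R. \<Sum>k = 1..n. if k \<le> ?r l then 2 * k else 0)"
  proof (rule sum_mono, rule square_le_sum_levels)
    fix l
    have "?r l \<le> card Y" by (intro card_mono fin) auto
    then show "?r l \<le> n" using Y by linarith
  qed
  also have "\<dots> = (\<Sum>k = 1..n. \<Sum>l\<in>?R. if k \<le> ?r l then 2 * k else 0)" by (rule sum.swap)
  also have "\<dots> = (\<Sum>k = 1..n. 2 * k * card (L k))"
  proof (rule sum.cong[OF refl])
    fix k
    have "?R \<inter> {l. k \<le> ?r l} = L k" by (auto simp: L_def)
    then show "(\<Sum>l\<in>?R. if k \<le> ?r l then 2 * k else 0) = 2 * k * card (L k)"
      using fin by (simp add: sum.If_cases)
  qed
  finally show ?thesis .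
qed

text \<open>If the weight is at least \<open>q\<close> on \<open>Y\<close>, the weighted count
  dominates q^2 times the plain count over any set of ratios. On the k-popular ratios this bounds
  their number by B^2 / (q^4 k^2), and summation over \<open>k\<close> costs one more harmonic
  sum.\<close>

lemma Emult_le_of_weight:
  fixes \<rho> :: "real \<Rightarrow> nat" and q :: real
  assumes fin: "finite A" "finite D" and A: "0 \<notin> A"
    and Y: "Y \<subseteq> A" and D: "\<And>a b. a \<in> A \<Longrightarrow> b \<in> A \<Longrightarrow> a - b \<in> D"
    and \<rho>: "\<And>d. \<rho> d \<le> N"
    and q: "q \<ge> 0" "\<And>y. y \<in> Y \<Longrightarrow> q \<le> real (\<Sum>a\<in>A. \<rho> (a - y) ^ 2)"
  defines "B \<equiv> 384 * harmonic_sum (card A) * harmonic_sum N ^ 2 * real (card A) powr (5/3)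
      * real (\<Sum>d\<in>D. \<rho> d ^ 3) powr (4/3)"
  shows "q ^ 4 * real (Emult Y) \<le> 2 * harmonic_sum (card A) * B\<^sup>2"
proof -
  define f where "f = (\<lambda>y. \<Sum>a\<in>A. \<rho> (a - y) ^ 2)"
  define L where "L = (\<lambda>k. {l \<in> (\<lambda>(y, z). z / y) ` (Y \<times> Y). k \<le> card {y \<in> Y. l * y \<in> Y}})"
  let ?n = "card A"
  have finY: "finite Y" and cY: "card Y \<le> ?n" and Y0: "0 \<notin> Y"
    using fin Y A by (auto intro: finite_subset card_mono)
  have finL: "finite (L k)" for k using finY by (simp add: L_def)
  have B: "B \<ge> 0" by (auto simp: B_def harmonic_sum_def intro!: mult_nonneg_nonneg sum_nonneg)
  have key: "q ^ 4 * (2 * real k * real (card (L k))) \<le> 2 * B\<^sup>2 / real k" if k: "k > 0" for k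
  proof -
    define w where "w = real (card (L k))"
    let ?V = "SIGMA l : L k. {y \<in> Y. l * y \<in> Y}"
    have cL: "card (L k) \<le> ?n\<^sup>2"
    proof -
      have "card (L k) \<le> card ((\<lambda>(y, z). z / y) ` (Y \<times> Y))"
        by (intro card_mono) (use finY in \<open>auto simp: L_def\<close>)
      also have "\<dots> \<le> card (Y \<times> Y)" by (intro card_image_le) (use finY in auto)
      also have "\<dots> \<le> ?n\<^sup>2" using cY by (simp add: card_cartesian_product power2_eq_square mult_le_mono)
      finally show ?thesis .
    qed
    have L0: "0 \<notin> L k" using Y0 by (auto simp: L_def)
    have "k * card (L k) = (\<Sum>l\<in>L k. k)" by simp
    also have "\<dots> \<le> (\<Sum>l\<in>L k. card {y \<in> Y. l * y \<in> Y})"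
      by (rule sum_mono) (simp add: L_def)
    also have "\<dots> = card ?V" using finL finY by (subst card_SigmaI) auto
    finally have "real (k * card (L k)) \<le> real (card ?V)" by (rule of_nat_mono)
    \<comment> \<open>At least \<open>k * w\<close> pairs (l, y) have both y and l*y in
      \<open>Y\<close>, and each contributes at least q^2 to the weighted count.\<close>
    then have "q\<^sup>2 * (real k * w) \<le> q\<^sup>2 * real (card ?V)"
      by (intro mult_left_mono) (auto simp: w_def)
    also have "\<dots> = (\<Sum>(l, y)\<in>?V. q * q)"
      using finL finY by (simp add: power2_eq_square case_prod_unfold)
    also have "\<dots> \<le> (\<Sum>(l, y)\<in>?V. real (f y) * real (f (l * y)))"
      using q by (intro sum_mono) (auto simp: f_def intro!: mult_mono sum_nonneg)
    also have "\<dots> = real (\<Sum>(l, y)\<in>?V. f y * f (l * y))" by (simp add: case_prod_unfold)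
    also have "\<dots> \<le> B * w powr (1/2)"
      using weighted_ratio_count[of A "L k" D Y \<rho> N f, OF fin(1) finL fin(2) L0 cL Y D \<rho>]
      by (simp add: f_def B_def w_def mult_ac)
    finally have le: "q\<^sup>2 * (real k * w) \<le> B * w powr (1/2)" .
    have "(w powr (1/2))\<^sup>2 = w"
      by (simp add: power2_eq_square w_def flip: powr_add)
    then have "(q\<^sup>2 * (real k * w))\<^sup>2 \<le> B\<^sup>2 * w"
      using power_mono[OF le, of 2] by (simp add: power_mult_distrib w_def)
    \<comment> \<open>Squaring turns the square root of \<open>w\<close> into a full factor, which
      then cancels.\<close>
    then have "w * (q ^ 4 * real k ^ 2 * w) \<le> w * B\<^sup>2"
      by (simp add: power_mult_distrib power_numeral_reduce mult_ac)
    then have "q ^ 4 * real k ^ 2 * w \<le> B\<^sup>2"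
      by (cases "w = 0") (auto simp: w_def)
    then show ?thesis using k by (simp add: w_def field_simps power2_eq_square)
  qed
  have "Emult Y \<le> (\<Sum>k = 1..?n. 2 * k * card (L k))"
    unfolding L_def by (rule Emult_level_bound[OF finY Y0 cY])
  then have "real (Emult Y) \<le> real (\<Sum>k = 1..?n. 2 * k * card (L k))" by (rule of_nat_mono)
  then have "q ^ 4 * real (Emult Y) \<le> q ^ 4 * (\<Sum>k = 1..?n. 2 * real k * real (card (L k)))"
    by (intro mult_left_mono) auto
  also have "\<dots> = (\<Sum>k = 1..?n. q ^ 4 * (2 * real k * real (card (L k))))"
    by (rule sum_distrib_left)
  also have "\<dots> \<le> (\<Sum>k = 1..?n. 2 * B\<^sup>2 / real k)"
    by (intro sum_mono key) auto
  also have "\<dots> = 2 * harmonic_sum ?n * B\<^sup>2"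
    by (simp add: harmonic_sum_def sum_distrib_left sum_distrib_right mult_ac)
  finally show ?thesis .
qed

section \<open>Sets of minimal third energy\<close>

lemma rdiff_eq: "rdiff X d = card {b \<in> X. b + d \<in> X}"
proof -
  have "bij_betw (\<lambda>b. (b + d, b)) {b \<in> X. b + d \<in> X} {(a, b). a \<in> X \<and> b \<in> X \<and> a - b = d}"
    by (rule bij_betw_byWitness[where f' = snd]) auto
  then show ?thesis unfolding rdiff_def by (simp add: bij_betw_same_card)
qed

lemma rdiff_minus: "rdiff X (- d) = rdiff X d"
proof -
  have "bij_betw prod.swap {(a, b). a \<in> X \<and> b \<in> X \<and> a - b = d} {(a, b). a \<in> X \<and> b \<in> X \<and> a - b = - d}"
    by (rule bij_betw_byWitness[where f' = prod.swap]) auto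
  then show ?thesis unfolding rdiff_def by (simp add: bij_betw_same_card)
qed

lemma rdiff_zero: "rdiff X 0 = card X"
  by (simp add: rdiff_eq)

lemma rdiff_mono: "finite X \<Longrightarrow> W \<subseteq> X \<Longrightarrow> rdiff W d \<le> rdiff X d"
  unfolding rdiff_eq by (intro card_mono) auto

lemma rdiff_le_card: "finite X \<Longrightarrow> rdiff X d \<le> card X"
  unfolding rdiff_eq by (intro card_mono) auto

definition diff_set :: "real set \<Rightarrow> real set" where
  "diff_set A = {a - b | a b. a \<in> A \<and> b \<in> A}"

lemma diff_set_image: "diff_set A = (\<lambda>(a, b). a - b) ` (A \<times> A)"
  by (auto simp: diff_set_def)

lemma diff_set_mono: "X \<subseteq> A \<Longrightarrow> diff_set X \<subseteq> diff_set A"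
  by (auto simp: diff_set_def)

lemma finite_diff_set: "finite A \<Longrightarrow> finite (diff_set A)"
  by (simp add: diff_set_image)

lemma card_diff_set_le: "finite A \<Longrightarrow> card (diff_set A) \<le> (card A)\<^sup>2"
  unfolding diff_set_image power2_eq_square card_cartesian_product[symmetric]
  by (rule card_image_le) simp

text \<open>Representation counts vanish off the difference set. Energies of different subsets of
  \<open>A\<close> can therefore be compared term by term over one index set.\<close>

lemma E3plus_eq_sum:
  assumes "finite D" "diff_set X \<subseteq> D"
  shows "E3plus X = (\<Sum>d\<in>D. rdiff X d ^ 3)"
proof -
  have "rdiff X d = 0" if "d \<notin> diff_set X" for d
  proof -
    have "{b \<in> X. b + d \<in> X} = {}"
    proof (rule ccontr)
      assume "{b \<in> X. b + d \<in> X} \<noteq> {}"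
      then obtain b where "b \<in> X" "b + d \<in> X" by auto
      then have "(b + d) - b \<in> diff_set X" unfolding diff_set_def by blast
      with that show False by simp
    qed
    then show ?thesis unfolding rdiff_eq by (simp only: card.empty)
  qed
  then have "(\<Sum>d\<in>diff_set X. rdiff X d ^ 3) = (\<Sum>d\<in>D. rdiff X d ^ 3)"
    using assms by (intro sum.mono_neutral_left) auto
  then show ?thesis by (simp add: E3plus_def diff_set_def)
qed

text \<open>A difference d comes from r(d) pairs, each contributing r(d)^2. This form distributes
  the energy over the elements x, so that one of them carries at least the average.\<close>

lemma E3plus_eq_sum_pairs:
  assumes "finite X"
  shows "E3plus X = (\<Sum>x\<in>X. \<Sum>a\<in>X. rdiff X (a - x) ^ 2)"
proof -
  let ?sub = "\<lambda>(a, b). a - b :: real"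
  have "(\<Sum>x\<in>X. \<Sum>a\<in>X. rdiff X (a - x) ^ 2) = (\<Sum>a\<in>X. \<Sum>x\<in>X. rdiff X (a - x) ^ 2)"
    by (rule sum.swap)
  also have "\<dots> = (\<Sum>z\<in>X \<times> X. rdiff X (?sub z) ^ 2)"
    unfolding sum.cartesian_product by (simp add: case_prod_unfold)
  also have "\<dots> = (\<Sum>d\<in>?sub ` (X \<times> X). \<Sum>z | z \<in> X \<times> X \<and> ?sub z = d. rdiff X (?sub z) ^ 2)"
    using assms by (intro sum.image_gen) auto
  also have "\<dots> = (\<Sum>d\<in>diff_set X. rdiff X d ^ 3)"
    unfolding diff_set_image
  proof (rule sum.cong[OF refl])
    fix d
    have "{z. z \<in> X \<times> X \<and> ?sub z = d} = {(a, b). a \<in> X \<and> b \<in> X \<and> a - b = d}" by auto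
    then have "card {z. z \<in> X \<times> X \<and> ?sub z = d} = rdiff X d" by (simp add: rdiff_def)
    moreover have "(\<Sum>z | z \<in> X \<times> X \<and> ?sub z = d. rdiff X (?sub z) ^ 2)
        = card {z. z \<in> X \<times> X \<and> ?sub z = d} * rdiff X d ^ 2" by simp
    ultimately show "(\<Sum>z | z \<in> X \<times> X \<and> ?sub z = d. rdiff X (?sub z) ^ 2) = rdiff X d ^ 3"
      by (simp add: power3_eq_cube power2_eq_square)
  qed
  finally show ?thesis by (simp add: E3plus_def diff_set_def)
qed

text \<open>Each difference a - x with a in \<open>X\<close> loses at least the representation (a,
  x). If a count drops from v to u < v, then v^3 - u^3 is at least v^2.\<close>

lemma E3plus_remove:
  assumes "finite X" "x \<in> X"
  shows "E3plus (X - {x}) + (\<Sum>a\<in>X. rdiff X (a - x) ^ 2) \<le> E3plus X"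
proof -
  let ?W = "X - {x}" and ?T = "(\<lambda>a. a - x) ` X" and ?D = "diff_set X"
  have T: "?T \<subseteq> ?D" using assms by (auto simp: diff_set_def)
  have fD: "finite ?D" using assms by (simp add: finite_diff_set)
  have "(\<Sum>a\<in>X. rdiff X (a - x) ^ 2) = (\<Sum>d\<in>?T. rdiff X d ^ 2)"
    by (subst sum.reindex) (auto simp: inj_on_def)
  also have "\<dots> = (\<Sum>d\<in>?D. if d \<in> ?T then rdiff X d ^ 2 else 0)"
    using T fD by (simp add: sum.inter_restrict[symmetric] Int_absorb1)
  finally have "E3plus ?W + (\<Sum>a\<in>X. rdiff X (a - x) ^ 2)
      = (\<Sum>d\<in>?D. rdiff ?W d ^ 3 + (if d \<in> ?T then rdiff X d ^ 2 else 0))"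
    using E3plus_eq_sum[OF fD diff_set_mono, of ?W] by (simp add: sum.distrib)
  also have "\<dots> \<le> (\<Sum>d\<in>?D. rdiff X d ^ 3)"
  proof (rule sum_mono)
    fix d
    define u v where "u = rdiff ?W d" and "v = rdiff X d"
    have uv: "u \<le> v" unfolding u_def v_def using assms by (intro rdiff_mono) auto
    show "rdiff ?W d ^ 3 + (if d \<in> ?T then rdiff X d ^ 2 else 0) \<le> rdiff X d ^ 3"
    proof (cases "d \<in> ?T")
      case False
      then show ?thesis using uv by (simp add: u_def v_def power_mono)
    next
      case True
      then have "x \<in> {b \<in> X. b + d \<in> X}" "x \<notin> {b \<in> ?W. b + d \<in> ?W}" using assms by auto
      then have "{b \<in> ?W. b + d \<in> ?W} \<subset> {b \<in> X. b + d \<in> X}" by blast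
      then have "u + 1 \<le> v"
        unfolding u_def v_def rdiff_eq using assms by (simp add: Suc_le_eq psubset_card_mono)
      have "u ^ 3 + v\<^sup>2 \<le> u * v\<^sup>2 + v\<^sup>2"
        using uv by (simp add: power3_eq_cube power2_eq_square mult_le_mono)
      also have "\<dots> = (u + 1) * v\<^sup>2" by simp
      also have "\<dots> \<le> v * v\<^sup>2" using \<open>u + 1 \<le> v\<close> by (rule mult_le_mono1)
      also have "\<dots> = v ^ 3" by (simp add: power3_eq_cube power2_eq_square)
      finally have "u ^ 3 + v\<^sup>2 \<le> v ^ 3" .
      then show ?thesis using True by (simp add: u_def v_def)
    qed
  qed
  also have "\<dots> = E3plus X" using fD by (simp add: E3plus_eq_sum)
  finally show ?thesis .
qed

text \<open>Only differences involving \<open>y\<close> gain representations, and at most two each;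
  this is the origin of the shift by 2 in the weight.\<close>

lemma E3plus_insert:
  assumes fin: "finite A" and W: "insert y W \<subseteq> A"
  shows "E3plus (insert y W) \<le> E3plus W + 12 * (\<Sum>a\<in>A. (rdiff W (a - y) + 2) ^ 2)"
proof -
  let ?Z = "insert y W" and ?D = "diff_set A"
  let ?g = "\<lambda>d. (rdiff W d + 2) ^ 2"
  define T where "T = (\<lambda>a. a - y) ` A \<union> (\<lambda>a. y - a) ` A"
  have fW: "finite W" using fin W by (auto intro: finite_subset)
  have fD: "finite ?D" using fin by (simp add: finite_diff_set)
  have TD: "T \<subseteq> ?D" using W by (auto simp: T_def diff_set_def)
  have "E3plus ?Z = (\<Sum>d\<in>?D. rdiff ?Z d ^ 3)"
    using W by (intro E3plus_eq_sum fD) (auto simp: diff_set_def)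
  also have "\<dots> \<le> (\<Sum>d\<in>?D. rdiff W d ^ 3 + (if d \<in> T then 6 * ?g d else 0))"
  proof (rule sum_mono)
    fix d
    show "rdiff ?Z d ^ 3 \<le> rdiff W d ^ 3 + (if d \<in> T then 6 * ?g d else 0)"
    proof (cases "d \<in> T")
      case False
      have "{b \<in> ?Z. b + d \<in> ?Z} = {b \<in> W. b + d \<in> W}"
      proof (intro equalityI subsetI)
        fix b assume "b \<in> {b \<in> ?Z. b + d \<in> ?Z}"
        then have b: "b \<in> ?Z" "b + d \<in> ?Z" by auto
        have "b \<noteq> y"
        proof
          assume "b = y"
          then have "d = (b + d) - y" by simp
          then show False using b W False unfolding T_def by blast
        qed
        moreover have "b + d \<noteq> y"
        proof
          assume "b + d = y"
          then have "d = y - b" by simp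
          then show False using b W False unfolding T_def by blast
        qed
        ultimately show "b \<in> {b \<in> W. b + d \<in> W}" using b by auto
      qed auto
      then show ?thesis by (simp add: rdiff_eq)
    next
      case True
      \<comment> \<open>A new representation has \<open>y\<close> either as its smaller term b or as
        b + d.\<close>
      have "{b \<in> ?Z. b + d \<in> ?Z} \<subseteq> {b \<in> W. b + d \<in> W} \<union> {y, y - d}" by auto
      then have "rdiff ?Z d \<le> card ({b \<in> W. b + d \<in> W} \<union> {y, y - d})"
        unfolding rdiff_eq by (intro card_mono) (use fW in auto)
      also have "\<dots> \<le> rdiff W d + card {y, y - d}"
        unfolding rdiff_eq by (rule card_Un_le)
      also have "card {y, y - d} \<le> 2" by (simp add: card_insert_if)
      finally have "rdiff ?Z d ^ 3 \<le> (rdiff W d + 2) ^ 3" by (intro power_mono) auto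
      also have "\<dots> \<le> rdiff W d ^ 3 + 6 * ?g d"
        by (simp add: power3_eq_cube power2_eq_square algebra_simps)
      finally show ?thesis using True by simp
    qed
  qed
  also have "\<dots> = E3plus W + (\<Sum>d\<in>T. 6 * ?g d)"
  proof -
    have "(\<Sum>d\<in>?D. rdiff W d ^ 3) = E3plus W"
      using W by (intro E3plus_eq_sum[symmetric] fD) (auto simp: diff_set_def)
    then show ?thesis
      using TD fD by (simp add: sum.distrib sum.inter_restrict[symmetric] Int_absorb1)
  qed
  \<comment> \<open>The differences a - y and y - a contribute equally because representation counts
    are even, which doubles 6 to 12.\<close>
  also have "(\<Sum>d\<in>T. 6 * ?g d) \<le> 12 * (\<Sum>a\<in>A. ?g (a - y))"
  proof -
    have "(\<Sum>d\<in>T. ?g d) \<le> (\<Sum>d\<in>(\<lambda>a. a - y) ` A. ?g d) + (\<Sum>d\<in>(\<lambda>a. y - a) ` A. ?g d)"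
      unfolding T_def using fin by (simp add: sum_Un_nat)
    also have "(\<Sum>d\<in>(\<lambda>a. a - y) ` A. ?g d) = (\<Sum>a\<in>A. ?g (a - y))"
      by (subst sum.reindex) (auto simp: inj_on_def)
    also have "(\<Sum>d\<in>(\<lambda>a. y - a) ` A. ?g d) = (\<Sum>a\<in>A. ?g (y - a))"
      by (subst sum.reindex) (auto simp: inj_on_def)
    also have "\<dots> = (\<Sum>a\<in>A. ?g (a - y))"
      by (intro sum.cong refl) (metis minus_diff_eq rdiff_minus)
    finally show ?thesis by (simp add: sum_distrib_left[symmetric])
  qed
  finally show ?thesis by simp
qed

text \<open>With F(x) and g(y) the removal and insertion weights, minimality gives E3(X) <= E3(X - x
  + y) <= E3(X) - F(x) + 12 g(y), hence F(x) <= 12 g(y). One x of at least average F serves as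
  exchange partner for every y outside \<open>X\<close>.\<close>

lemma exists_E3plus_minimal_split:
  assumes fin: "finite A" and ne: "A \<noteq> {}"
  obtains X Y where "X \<subseteq> A" "Y \<subseteq> A" "X \<union> Y = A"
    "card A \<le> 2 * card X" "card A \<le> 2 * card Y"
    "\<And>y. y \<in> Y \<Longrightarrow> E3plus X \<le> 12 * card A * (\<Sum>a\<in>A. (rdiff X (a - y) + 2) ^ 2)"
proof -
  \<comment> \<open>Half of \<open>A\<close>, rounded up. For odd \<open>card A\<close> the
    complement of \<open>X\<close> is then too small by one, and adding x to it restores the
    required size.\<close>
  define m where "m = (card A + 1) div 2"
  have cA: "card A > 0" using assms by (simp add: card_gt_0_iff)
  have m: "0 < m" "m \<le> card A" "card A \<le> 2 * m" "2 * m \<le> card A + 1"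
    using cA by (auto simp: m_def)
  obtain X0 where "X0 \<subseteq> A" "card X0 = m" using m by (meson obtain_subset_with_card_n)
  then have "\<exists>Z. (Z \<subseteq> A \<and> card Z = m) \<and> (\<forall>Z'. Z' \<subseteq> A \<and> card Z' = m \<longrightarrow> E3plus Z \<le> E3plus Z')"
    by (intro ex_has_least_nat[of "\<lambda>Z. Z \<subseteq> A \<and> card Z = m" X0]) simp
  then obtain X where X: "X \<subseteq> A" "card X = m"
    and min: "\<And>Z. Z \<subseteq> A \<Longrightarrow> card Z = m \<Longrightarrow> E3plus X \<le> E3plus Z"
    by auto
  have fX: "finite X" using X fin by (auto intro: finite_subset)
  define F where "F = (\<lambda>x. \<Sum>a\<in>X. rdiff X (a - x) ^ 2)"
  have "\<exists>x\<in>X. E3plus X \<le> card X * F x"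
  proof (rule ccontr)
    assume "\<not> ?thesis"
    then have "card X * F x < E3plus X" if "x \<in> X" for x using that by (auto simp: not_le)
    moreover have "X \<noteq> {}" using X m by auto
    ultimately have "(\<Sum>x\<in>X. card X * F x) < (\<Sum>x\<in>X. E3plus X)"
      using fX by (intro sum_strict_mono)
    then show False by (simp add: E3plus_eq_sum_pairs[OF fX] F_def sum_distrib_left[symmetric])
  qed
  then obtain x where x: "x \<in> X" "E3plus X \<le> card X * F x" by blast
  have le: "E3plus X \<le> card A * F x"
    using x(2) X m by (meson le_trans mult_le_mono1)
  define g where "g = (\<lambda>y. \<Sum>a\<in>A. (rdiff X (a - y) + 2) ^ 2)"
  \<comment> \<open>For y = x no exchange takes place: g(x) dominates F(x) termwise.\<close>
  have Fg: "F x \<le> 12 * g y" if "y \<in> insert x (A - X)" for y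
  proof (cases "y = x")
    case True
    have "F x \<le> (\<Sum>a\<in>X. (rdiff X (a - x) + 2) ^ 2)"
      unfolding F_def by (intro sum_mono power_mono) auto
    also have "\<dots> \<le> g x" unfolding g_def using fin X by (intro sum_mono2) auto
    finally show ?thesis using True by simp
  next
    case False
    then have y: "y \<in> A" "y \<notin> X" using that by auto
    let ?W = "X - {x}"
    have "card (insert y ?W) = m" using X y x fX m by (simp add: card_insert_if)
    then have "E3plus X \<le> E3plus (insert y ?W)" using X y by (intro min) auto
    also have "\<dots> \<le> E3plus ?W + 12 * (\<Sum>a\<in>A. (rdiff ?W (a - y) + 2) ^ 2)"
      using X y by (intro E3plus_insert fin) auto
    also have "(\<Sum>a\<in>A. (rdiff ?W (a - y) + 2) ^ 2) \<le> g y"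
      unfolding g_def using fX by (intro sum_mono power_mono add_mono rdiff_mono) auto
    finally have "E3plus X \<le> E3plus ?W + 12 * g y" by simp
    moreover have "E3plus ?W + F x \<le> E3plus X"
      unfolding F_def by (rule E3plus_remove[OF fX x(1)])
    ultimately show ?thesis by linarith
  qed
  show ?thesis
  proof
    show "X \<subseteq> A" "insert x (A - X) \<subseteq> A" "X \<union> insert x (A - X) = A" using X x by auto
    show "card A \<le> 2 * card X" using m X by simp
    have "card (insert x (A - X)) = card A - m + 1"
      using x X fin fX by (simp add: card_Diff_subset)
    then show "card A \<le> 2 * card (insert x (A - X))" using m by linarith
    fix y assume "y \<in> insert x (A - X)"
    then have "card A * F x \<le> card A * (12 * g y)" by (intro mult_le_mono2 Fg)
    with le have "E3plus X \<le> 12 * card A * g y" by linarith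
    then show "E3plus X \<le> 12 * card A * (\<Sum>a\<in>A. (rdiff X (a - y) + 2) ^ 2)"
      unfolding g_def .
  qed
qed

text \<open>The shift by 2 costs a constant factor and a constant per difference. There are at most
  |A|^2 differences, which is absorbed since r(0) = |X| already gives E3(X) >= |X|^3. The constant
  is 288 = 32 + 32 * 8.\<close>

lemma sum_rdiff_cube_le:
  assumes fin: "finite A" and X: "X \<subseteq> A" "card A \<le> 2 * card X"
  shows "(\<Sum>d\<in>diff_set A. (rdiff X d + 2) ^ 3) \<le> 288 * E3plus X"
proof -
  let ?D = "diff_set A"
  have fX: "finite X" using fin X by (auto intro: finite_subset)
  have "(u + 2) ^ 3 \<le> 32 * u ^ 3 + 32" for u :: nat
  proof (cases "u = 0")
    case False
    then have "(u + 2) ^ 3 \<le> (3 * u) ^ 3" by (intro power_mono) auto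
    then show ?thesis by (simp add: power_mult_distrib)
  qed (simp add: power3_eq_cube)
  then have "(\<Sum>d\<in>?D. (rdiff X d + 2) ^ 3) \<le> (\<Sum>d\<in>?D. 32 * rdiff X d ^ 3 + 32)"
    by (rule sum_mono)
  also have "\<dots> = 32 * E3plus X + 32 * card ?D"
    using E3plus_eq_sum[OF finite_diff_set[OF fin] diff_set_mono[OF X(1)]]
    by (simp add: sum.distrib sum_distrib_left)
  also have "card ?D \<le> 8 * E3plus X"
  proof (cases "X = {}")
    case True
    then have "A = {}" using X fin by simp
    then show ?thesis by (simp add: diff_set_def)
  next
    case False
    then have "0 \<in> diff_set X" by (force simp: diff_set_def)
    then have "rdiff X 0 ^ 3 \<le> (\<Sum>d\<in>diff_set X. rdiff X d ^ 3)"
      using fX by (intro member_le_sum finite_diff_set) auto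
    then have E: "card X ^ 3 \<le> E3plus X"
      using E3plus_eq_sum[OF finite_diff_set[OF fX] order_refl] by (simp add: rdiff_zero)
    have "card ?D \<le> (card A)\<^sup>2" by (rule card_diff_set_le[OF fin])
    also have "\<dots> \<le> (card A) ^ 3" by (cases "card A = 0") (auto intro: power_increasing)
    also have "\<dots> \<le> (2 * card X) ^ 3" using X by (intro power_mono) auto
    also have "\<dots> \<le> 8 * E3plus X" using E by (simp add: power_mult_distrib)
    finally show ?thesis .
  qed
  finally show ?thesis by simp
qed

section \<open>Logarithmic bounds and combination of the estimates\<close>

lemma harmonic_sum_le:
  assumes "m > 0"
  shows "harmonic_sum m \<le> 1 + ln (real m)"
  using assms
proof (induction m rule: nat_induct_non_zero)
  case 1
  then show ?case by (simp add: harmonic_sum_def)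
next
  case (Suc m)
  have "ln (real m / real (Suc m)) \<le> real m / real (Suc m) - 1"
    using Suc by (intro ln_le_minus_one) auto
  then have "1 / real (Suc m) \<le> ln (real (Suc m)) - ln (real m)"
    using Suc by (simp add: ln_div field_simps)
  moreover have "harmonic_sum (Suc m) = harmonic_sum m + 1 / real (Suc m)"
    by (simp add: harmonic_sum_def)
  ultimately show ?case using Suc by simp
qed

text \<open>The range up to n + 2 covers the thresholds of the shifted representation counts. Since
  1 <= 2 ln(2 + n), the additive 1 is absorbed and the factor is 2 + 1 = 3.\<close>

lemma harmonic_sum_le_log:
  assumes "m \<le> n + 2"
  shows "harmonic_sum m \<le> 3 * ln (2 + real n)"
proof (cases "m = 0")
  case True
  then show ?thesis by (simp add: harmonic_sum_def)
next
  case False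
  have "ln (1 / 2) \<le> (1 / 2 - 1 :: real)" by (rule ln_le_minus_one) simp
  then have "1 / 2 \<le> ln (2 :: real)" by (simp add: ln_div)
  also have "ln 2 \<le> ln (2 + real n)" by simp
  finally have "1 \<le> 2 * ln (2 + real n)" by simp
  moreover have "ln (real m) \<le> ln (2 + real n)" using assms False by simp
  ultimately show ?thesis using harmonic_sum_le[of m] False by linarith
qed

text \<open>The weight estimate is used with \<rho> = r + 2, q = E/(12 n) and N = n + 2. After
  cubing, E^12 M^3 is at most a constant times n^22 E^8 and 21 logarithms.\<close>

lemma energy_product_bound:
  assumes fin: "finite A" and A: "0 \<notin> A" and XY: "X \<subseteq> A" "Y \<subseteq> A"
    and cX: "card A \<le> 2 * card X" and ne: "A \<noteq> {}"
    and Y: "\<And>y. y \<in> Y \<Longrightarrow> E3plus X \<le> 12 * card A * (\<Sum>a\<in>A. (rdiff X (a - y) + 2) ^ 2)"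
  shows "real (E3plus X) ^ 4 * real (Emult Y) ^ 3
    \<le> (8 * 384 ^ 6 * 12 ^ 12 * 288 ^ 8 * 3 ^ 21) * real (card A) ^ 22 * ln (2 + real (card A)) ^ 21"
proof -
  define n E M where "n = real (card A)" and "E = real (E3plus X)" and "M = real (Emult Y)"
  define h H l where "h = harmonic_sum (card A)" and "H = harmonic_sum (card A + 2)"
    and "l = ln (2 + real (card A))"
  define G where "G = real (\<Sum>d\<in>diff_set A. (rdiff X d + 2) ^ 3)"
  define U where "U = n powr (5/3) * G powr (4/3)"
  have n: "n > 0" using fin ne by (simp add: n_def card_gt_0_iff)
  have fX: "finite X" using fin XY by (auto intro: finite_subset)
  have h: "0 \<le> h" "h \<le> 3 * l" and H: "0 \<le> H" "H \<le> 3 * l"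
    unfolding h_def H_def l_def
    by (simp_all only: harmonic_sum_le_log le_add1 order_refl) (auto simp only: harmonic_sum_def intro!: sum_nonneg divide_nonneg_nonneg of_nat_0_le_iff zero_le_one)
  have GE: "G \<le> 288 * E"
    using of_nat_mono[OF sum_rdiff_cube_le[OF fin XY(1) cX], where 'a = real]
    unfolding G_def E_def by simp
  have G0: "G \<ge> 0" by (simp add: G_def sum_nonneg)
  show ?thesis
  \<comment> \<open>A vanishing energy is split off because E^8 is cancelled at the end.\<close>
  proof (cases "E = 0")
    case True
    then show ?thesis by (simp add: E_def)
  next
    case False
    then have E: "E > 0" by (simp add: E_def)
    have G: "G > 0"
    proof -
      have "0 \<in> diff_set A" using ne by (force simp: diff_set_def)
      then have "(rdiff X 0 + 2) ^ 3 \<le> (\<Sum>d\<in>diff_set A. (rdiff X d + 2) ^ 3)"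
        by (intro member_le_sum finite_diff_set fin) auto
      moreover have "0 < (rdiff X 0 + 2) ^ 3" by simp
      ultimately show ?thesis unfolding G_def by linarith
    qed
    have U3: "U ^ 3 = n ^ 5 * G ^ 4"
    proof -
      have "(n powr (5/3)) ^ 3 = n powr 5" "(G powr (4/3)) ^ 3 = G powr 4"
        using n G by (simp_all add: powr_power)
      then show ?thesis using n G by (simp add: U_def power_mult_distrib)
    qed
    have "(E / (12 * n)) ^ 4 * M \<le> 2 * h * (384 * h * H\<^sup>2 * n powr (5/3) * G powr (4/3))\<^sup>2"
      unfolding E_def M_def n_def h_def H_def G_def
    proof (rule Emult_le_of_weight[OF fin finite_diff_set[OF fin] A XY(2)])
      show "a - b \<in> diff_set A" if "a \<in> A" "b \<in> A" for a b
        using that by (auto simp: diff_set_def)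
      show "rdiff X d + 2 \<le> card A + 2" for d
        using rdiff_le_card[OF fX, of d] card_mono[OF fin XY(1)] by simp
      show "0 \<le> real (E3plus X) / (12 * real (card A))" by simp
      show "real (E3plus X) / (12 * real (card A)) \<le> real (\<Sum>a\<in>A. (rdiff X (a - y) + 2)\<^sup>2)"
        if "y \<in> Y" for y
      proof -
        have "real (E3plus X) \<le> real (12 * card A * (\<Sum>a\<in>A. (rdiff X (a - y) + 2)\<^sup>2))"
          by (rule of_nat_mono[OF Y[OF that]])
        then show ?thesis using n by (simp add: n_def field_simps)
      qed
    qed
    \<comment> \<open>Seven logarithmic factors: three from harmonic sums up to n, four from those
      up to n + 2.\<close>
    also have "\<dots> = 2 * 384\<^sup>2 * (h ^ 3 * H ^ 4) * U\<^sup>2"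
      by (simp add: U_def power_mult_distrib power_numeral_reduce mult_ac)
    also have "\<dots> \<le> 2 * 384\<^sup>2 * ((3 * l) ^ 3 * (3 * l) ^ 4) * U\<^sup>2"
      using h H by (intro mult_right_mono mult_left_mono mult_mono power_mono) auto
    finally have le: "(E / (12 * n)) ^ 4 * M \<le> 2 * 384\<^sup>2 * (3 * l) ^ 7 * U\<^sup>2"
      by (simp flip: power_add)
    \<comment> \<open>Cubing clears the exponents 10/3 of \<open>n\<close> and 8/3 of
      \<open>G\<close> hidden in the square of \<open>U\<close>.\<close>
    have "((E / (12 * n)) ^ 4 * M) ^ 3 \<le> (2 * 384\<^sup>2 * (3 * l) ^ 7 * U\<^sup>2) ^ 3"
      using E n by (intro power_mono le) (auto simp: M_def)
    also have "\<dots> = 8 * 384 ^ 6 * (3 * l) ^ 21 * (U ^ 3)\<^sup>2"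
      by (simp only: power_mult_distrib flip: power_mult) simp
    also have "(U ^ 3)\<^sup>2 = n ^ 10 * G ^ 8" unfolding U3 by (simp add: power_mult_distrib flip: power_mult)
    also have "8 * 384 ^ 6 * (3 * l) ^ 21 * (n ^ 10 * G ^ 8)
        \<le> 8 * 384 ^ 6 * (3 * l) ^ 21 * (n ^ 10 * (288 * E) ^ 8)"
      using GE G n h by (intro mult_left_mono power_mono) auto
    finally have "((E / (12 * n)) ^ 4 * M) ^ 3 \<le> 8 * 384 ^ 6 * (3 * l) ^ 21 * (n ^ 10 * (288 * E) ^ 8)" .
    moreover have "((E / (12 * n)) ^ 4 * M) ^ 3 = E ^ 8 * (E ^ 4 * M ^ 3) / (12 ^ 12 * n ^ 12)"
      by (simp only: power_mult_distrib power_divide flip: power_mult mult.assoc power_add) simp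
    ultimately have "E ^ 8 * (E ^ 4 * M ^ 3)
        \<le> 8 * 384 ^ 6 * (3 * l) ^ 21 * (n ^ 10 * (288 * E) ^ 8) * (12 ^ 12 * n ^ 12)"
      using n by (simp only: pos_divide_le_eq zero_less_mult_iff zero_less_power zero_less_numeral simp_thms)
    also have "\<dots> = E ^ 8 * ((8 * 384 ^ 6 * 12 ^ 12 * 288 ^ 8 * 3 ^ 21) * (n ^ 10 * n ^ 12) * l ^ 21)"
      by (simp only: power_mult_distrib mult_ac)
    finally have "E ^ 4 * M ^ 3 \<le> (8 * 384 ^ 6 * 12 ^ 12 * 288 ^ 8 * 3 ^ 21) * (n ^ 10 * n ^ 12) * l ^ 21"
      using E by (simp only: mult_le_cancel_left_pos zero_less_power)
    moreover have "n ^ 10 * n ^ 12 = n ^ 22" by (simp flip: power_add)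
    ultimately show ?thesis unfolding E_def M_def n_def l_def by (simp only:)
  qed
qed

theorem mainTheorem10:
  shows "\<exists>C c. C > 0 \<and> c > 0 \<and>
    (\<forall>A :: real set. finite A \<and> 0 \<notin> A \<longrightarrow>
      (\<exists>X Y. X \<subseteq> A \<and> Y \<subseteq> A \<and> X \<union> Y = A \<and>
         real (card X) \<ge> real (card A) / 2 \<and> real (card Y) \<ge> real (card A) / 2 \<and>
         real (E3plus X) ^ 4 * real (Emult Y) ^ 3
           \<le> C * real (card A) ^ 22 * ln (2 + real (card A)) powr c))"
proof (rule exI[of _ "8 * 384 ^ 6 * 12 ^ 12 * 288 ^ 8 * 3 ^ 21"], rule exI[of _ 21], intro conjI allI impI)
  let ?C = "8 * 384 ^ 6 * 12 ^ 12 * 288 ^ 8 * 3 ^ 21 :: real"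
  show "?C > 0" "(21 :: real) > 0" by simp_all
  fix A :: "real set"
  assume A: "finite A \<and> 0 \<notin> A"
  show "\<exists>X Y. X \<subseteq> A \<and> Y \<subseteq> A \<and> X \<union> Y = A \<and>
      real (card X) \<ge> real (card A) / 2 \<and> real (card Y) \<ge> real (card A) / 2 \<and>
      real (E3plus X) ^ 4 * real (Emult Y) ^ 3
        \<le> ?C * real (card A) ^ 22 * ln (2 + real (card A)) powr 21"
  proof (cases "A = {}")
    \<comment> \<open>For empty \<open>A\<close> the empty sets serve as witnesses and the third
      energy is 0.\<close>
    case True
    then show ?thesis by (simp add: E3plus_def)
  next
    case False
    with A obtain X Y where XY: "X \<subseteq> A" "Y \<subseteq> A" "X \<union> Y = A"
      and c: "card A \<le> 2 * card X" "card A \<le> 2 * card Y"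
      and Y: "\<And>y. y \<in> Y \<Longrightarrow> E3plus X \<le> 12 * card A * (\<Sum>a\<in>A. (rdiff X (a - y) + 2) ^ 2)"
      using exists_E3plus_minimal_split by metis
    have "real (E3plus X) ^ 4 * real (Emult Y) ^ 3
        \<le> ?C * real (card A) ^ 22 * ln (2 + real (card A)) ^ 21"
      using A False XY c Y by (intro energy_product_bound) auto
    also have "ln (2 + real (card A)) ^ 21 = ln (2 + real (card A)) powr 21"
      by simp
    finally have "real (E3plus X) ^ 4 * real (Emult Y) ^ 3
        \<le> ?C * real (card A) ^ 22 * ln (2 + real (card A)) powr 21" .
    moreover have "real (card X) \<ge> real (card A) / 2" "real (card Y) \<ge> real (card A) / 2"
      using c by linarith+
    ultimately show ?thesis using XY by blast
  qed
qed

end
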